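(* The following hold. Let $\mathcal{C}$ be a distinct covering system with least modulus $m=4$ whose moduli have least common multiple $L = 2^a 3^b 5^c$, where $a,b,c$ are positive integers with $a \geq b \geq c$. Then: (i) $a \geq 3$. (ii) If $a=3$, then $b \geq 2$. (iv) If $b=1$, then $a \geq 5$. Moreover: (iii) There exists a distinct covering system with least modulus $m=4$ and least common multiple of its moduli equal to $2^3\cdot 3^2\cdot 5^1$. (v) There exists a distinct covering system with least modulus $m=4$ and least common multiple of its moduli equal to $2^5\cdot 3^1\cdot 5^1$, none of whose moduli is $240$.
   Context: A covering system is a finite set of congruences $x \equiv r_i \pmod{n_i}$, $i=1,\ldots,k$, such that every integer satisfies at least one of the congruences. A distinct covering system is a covering system in which all moduli $n_i$ are distinct integers greater than $1$. The least modulus $m$ is the smallest of the $n_i$, and $L$ is the least common multiple of all the $n_i$. *)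

theory Defs
  imports "HOL-Number_Theory.Cong"
begin

text \<open>The pair \<open>(r, n)\<close> stands for the congruence \<open>x \<equiv> r (mod n)\<close>.\<close>

type_synonym congruence = "int \<times> nat"

definition moduli :: "congruence set \<Rightarrow> nat set" where
  "moduli C = snd ` C"

definition covering_system :: "congruence set \<Rightarrow> bool" where
  "covering_system C \<longleftrightarrow>
     finite C \<and> (\<forall>n\<in>moduli C. n > 0) \<and> (\<forall>x::int. \<exists>(r, n)\<in>C. [x = r] (mod int n))"

text \<open>Distinctness of the moduli is injectivity of \<^term>\<open>snd\<close> on the set of congruences;
  in particular no residue class is listed twice through different representatives.\<close>

definition distinct_covering_system :: "congruence set \<Rightarrow> bool" where
  "distinct_covering_system C \<longleftrightarrow>
     covering_system C \<and> inj_on snd C \<and> (\<forall>n\<in>moduli C. n > 1)"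

definition least_modulus :: "congruence set \<Rightarrow> nat" where
  "least_modulus C = Min (moduli C)"

definition lcm_moduli :: "congruence set \<Rightarrow> nat" where
  "lcm_moduli C = Lcm (moduli C)"

end

theory Submission
  imports Defs
begin

text \<open>
  Fix \<open>M\<close> dividing \<open>L\<close> and look at the integers modulo \<open>L\<close> that lie over one residue \<open>x\<close> modulo \<open>M\<close>.
  A class modulo \<open>n\<close> meets this fibre only if \<open>x\<close> lies in a certain class modulo \<open>gcd M n\<close>, and
  then in \<open>L div lcm M n\<close> of its \<open>L div M\<close> points. So a cover gives a weighted inequality at
  every \<open>x\<close> (\<open>fibre_inequality\<close>), and only the arrangement of residue classes modulo \<open>M\<close> matters.

  The three exclusions come down to two values of \<open>L\<close>. If \<open>a \<le> 2\<close>, then all moduli divide \<open>900\<close>; if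
  \<open>b = 1\<close> and \<open>a \<le> 4\<close>, then \<open>c = 1\<close> and all moduli divide \<open>240\<close>. In both cases the reciprocals
  of the available moduli sum to more than \<open>1\<close>, so density alone decides nothing.

  For \<open>L = 900\<close> take \<open>M = 36\<close>. At a residue \<open>x\<close> left uncovered by the moduli dividing \<open>36\<close>, let \<open>v\<close>
  and \<open>w\<close> count the \<open>d > 1\<close> such that the modulus \<open>5 d\<close>, respectively \<open>25 d\<close>, hits the fibre of \<open>x\<close>.
  Since \<open>5\<close> and \<open>25\<close> always hit it, a cover needs \<open>5 v + w \<ge> 19\<close>. At least \<open>12\<close> residues are
  uncovered, while \<open>w \<ge> 4\<close> happens at no more than \<open>8\<close> residues (\<open>card_hits_ge_4\<close>), so \<open>v\<close> has to be
  large on the whole uncovered set. For \<open>L = 240\<close> take \<open>M = 48\<close>: now \<open>v \<ge> 4\<close> is needed on all of the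
  uncovered set, which again has at least \<open>12\<close> elements.

  The sum of \<open>v\<close> over the uncovered set \<open>R\<close> is the sum of the sizes \<open>card (R \<inter> C d)\<close>, where \<open>C d\<close>
  is the class modulo \<open>d\<close> in which \<open>5 d\<close> hits. This sum can be large enough only if the
  classes \<open>C d\<close> nearly avoid the classes of the moduli dividing \<open>M\<close>, and the latter have to be
  nearly pairwise disjoint, since their overlaps enlarge \<open>R\<close>. The parities of the residues make these demands incompatible
  (\<open>few_hits_outside_36\<close> and \<open>few_hits_outside_48\<close>).

  The two existence claims are settled by explicit systems, for which it is enough to test one
  representative of every residue modulo \<open>L\<close>.
\<close>

section \<open>Residue classes in an initial segment of the integers\<close>

lemmas gcd_lcm_numeral = gcd_non_0_nat lcm_nat_def

definition residue_class :: "nat \<Rightarrow> nat \<Rightarrow> int \<Rightarrow> int set" where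
  "residue_class M d r = {x \<in> {0..<int M}. [x = r] (mod int d)}"

lemma finite_residue_class [simp]: "finite (residue_class M d r)"
  unfolding residue_class_def by (rule finite_subset[of _ "{0..<int M}"]) auto

lemma residue_class_mono:
  assumes "e dvd d" and "[r = s] (mod int e)"
  shows "residue_class M d r \<subseteq> residue_class M e s"
proof -
  have "[x = s] (mod int e)" if "[x = r] (mod int d)" for x
    using cong_dvd_modulus[OF that, of "int e"] assms by (auto intro: cong_trans)
  thus ?thesis unfolding residue_class_def by blast
qed

lemma card_residue_class:
  assumes "d dvd M" and "M > 0"
  shows "card (residue_class M d r) = M div d"
proof -
  from assms obtain k where k: "M = d * k" by blast
  with assms have d: "d > 0" by simp
  let ?f = "\<lambda>i. r mod int d + int d * int i"
  have "residue_class M d r = ?f ` {..<k}"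
  proof (intro equalityI subsetI)
    fix x assume x: "x \<in> residue_class M d r"
    hence "x mod int d = r mod int d" and b: "0 \<le> x" "x < int d * int k"
      by (auto simp: residue_class_def cong_def k)
    have "int d * (x div int d) + x mod int d = x" by (rule mult_div_mod_eq)
    moreover have "x mod int d \<ge> 0" using d by simp
    ultimately have "int d * (x div int d) < int d * int k" using b by linarith
    hence "x div int d < int k" using d by (simp add: mult_less_cancel_left_pos)
    moreover have "x div int d \<ge> 0" using b d by (simp add: pos_imp_zdiv_nonneg_iff)
    ultimately have "nat (x div int d) < k" "x = ?f (nat (x div int d))"
      using \<open>x mod int d = r mod int d\<close> mult_div_mod_eq[of "int d" x] by simp_all
    thus "x \<in> ?f ` {..<k}" by blast
  next
    fix x assume "x \<in> ?f ` {..<k}"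
    then obtain i where i: "i < k" "x = ?f i" by blast
    have "r mod int d < int d" "0 \<le> r mod int d" using d by simp_all
    moreover have "int d * int i + int d \<le> int d * int k"
      using i by (metis Suc_leI distrib_left mult.right_neutral mult_le_mono2 of_nat_Suc of_nat_add
          of_nat_le_iff of_nat_mult add.commute mult_Suc_right)
    ultimately show "x \<in> residue_class M d r"
      using i(2) by (auto simp: residue_class_def cong_def k)
  qed
  moreover have "inj_on ?f {..<k}" using d by (auto simp: inj_on_def)
  ultimately have "card (residue_class M d r) = k" by (simp add: card_image)
  thus ?thesis using k d by simp
qed

text \<open>The Chinese remainder theorem for moduli that need not be coprime.\<close>

lemma residue_class_Int:
  assumes "[r = s] (mod int (gcd d e))"
  obtains t where "[t = r] (mod int d)" "[t = s] (mod int e)"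
    "\<And>M. residue_class M d r \<inter> residue_class M e s = residue_class M (lcm d e) t"
proof -
  obtain x where x: "[int d * x = gcd (int d) (int e)] (mod int e)"
    using cong_solve_int by blast
  from assms obtain q where q: "s - r = gcd (int d) (int e) * q"
    by (metis cong_iff_dvd_diff cong_sym dvdE gcd_int_int_eq)
  define t where "t = r + int d * x * q"
  have "[int d * x * q = gcd (int d) (int e) * q] (mod int e)"
    using x by (rule cong_scalar_right)
  hence te: "[t = s] (mod int e)"
    unfolding t_def q[symmetric] using cong_add[OF cong_refl[of r]] by fastforce
  have td: "[t = r] (mod int d)"
    unfolding t_def by (simp add: cong_iff_dvd_diff mult.assoc)
  have "[x = r] (mod int d) \<and> [x = s] (mod int e) \<longleftrightarrow> [x = t] (mod int (lcm d e))" for x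
  proof -
    have "[x = t] (mod int (lcm d e)) \<longleftrightarrow> [x = t] (mod int d) \<and> [x = t] (mod int e)"
      by (simp add: cong_iff_dvd_diff flip: lcm_int_int_eq)
    thus ?thesis using te td by (meson cong_sym cong_trans)
  qed
  hence "residue_class M d r \<inter> residue_class M e s = residue_class M (lcm d e) t" for M
    unfolding residue_class_def by blast
  with that td te show thesis by blast
qed

lemma card_residue_class_Int:
  assumes "lcm d e dvd M" and "M > 0"
  shows "card (residue_class M d r \<inter> residue_class M e s) =
    (if [r = s] (mod int (gcd d e)) then M div lcm d e else 0)"
proof (cases "[r = s] (mod int (gcd d e))")
  case True
  then obtain t where "residue_class M d r \<inter> residue_class M e s = residue_class M (lcm d e) t"
    using residue_class_Int by metis
  thus ?thesis using True card_residue_class[OF assms] by simp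
next
  case False
  have "residue_class M d r \<inter> residue_class M e s = {}"
  proof (rule ccontr)
    assume "residue_class M d r \<inter> residue_class M e s \<noteq> {}"
    then obtain x where "[x = r] (mod int d)" "[x = s] (mod int e)"
      by (auto simp: residue_class_def)
    hence "[x = r] (mod int (gcd d e))" "[x = s] (mod int (gcd d e))"
      by (auto intro: cong_dvd_modulus)
    with False show False by (meson cong_sym cong_trans)
  qed
  thus ?thesis using False by simp
qed

text \<open>A class modulo \<open>m\<close> splits into just two classes modulo \<open>2 * m\<close>.\<close>

lemma cong_halves:
  fixes x y z :: int
  assumes "[x = y] (mod m)" "[z = y] (mod m)"
    "\<not> [x = y] (mod 2 * m)" "\<not> [z = y] (mod 2 * m)"
  shows "[x = z] (mod 2 * m)"
proof -
  obtain i j where ij: "x - y = m * i" "z - y = m * j"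
    using assms(1,2) by (auto simp: cong_iff_dvd_diff elim!: dvdE)
  have "odd i" "odd j"
    using assms(3,4) ij by (auto simp: cong_iff_dvd_diff mult.commute)
  hence "2 dvd i - j" by simp
  moreover have "x - z = m * (i - j)" using ij by (simp add: algebra_simps)
  ultimately show ?thesis by (auto simp: cong_iff_dvd_diff mult.commute)
qed

lemma cong_2_iff_even: "[x = y] (mod 2) \<longleftrightarrow> (even x \<longleftrightarrow> even y)" for x y :: int
  by (simp add: cong_def) presburger

lemma residue_class_subset_parity:
  assumes "even d" "even r = even s"
  shows "residue_class M d r \<subseteq> residue_class M 2 s"
  using assms by (intro residue_class_mono) (simp_all add: cong_2_iff_even)

lemma residue_class_disjoint_parity:
  assumes "even d" "even r \<noteq> even s"
  shows "residue_class M d r \<inter> residue_class M 2 s = {}"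
proof -
  have "False" if "[x = r] (mod int d)" "[x = s] (mod int 2)" for x
  proof -
    have "[x = r] (mod 2)"
      by (rule cong_dvd_modulus[OF that(1)]) (use assms(1) in simp)
    with that(2) assms(2) show False by (simp add: cong_2_iff_even)
  qed
  thus ?thesis unfolding residue_class_def by blast
qed

lemma residue_class_2_Int_3:
  obtains t where "even t = even r"
    "residue_class M 2 r \<inter> residue_class M 3 s = residue_class M 6 t"
proof (rule residue_class_Int[of r s 2 3])
  show "[r = s] (mod int (gcd 2 3))" by (simp add: gcd_non_0_nat)
next
  fix t assume "[t = r] (mod int 2)" "[t = s] (mod int 3)"
    "\<And>M. residue_class M 2 r \<inter> residue_class M 3 s = residue_class M (lcm 2 3) t"
  thus thesis using that[of t] by (simp add: cong_2_iff_even lcm_nat_def gcd_non_0_nat)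
qed

section \<open>The points over a fixed residue\<close>

text \<open>
  The points over \<open>x\<close> form a residue class modulo \<open>M\<close>; the right-hand side adds up the sizes of
  its intersections with the covering classes.
\<close>

lemma fibre_inequality:
  assumes cover: "\<And>y::int. \<exists>n\<in>D. [y = \<rho> n] (mod int n)"
    and D: "finite D" "\<And>n. n \<in> D \<Longrightarrow> n dvd L" and M: "M dvd L" and L: "L > 0"
  shows "L div M \<le> (\<Sum>n\<in>D. of_bool ([x = \<rho> n] (mod int (gcd M n))) * (L div lcm M n))"
proof -
  let ?F = "residue_class L M x"
  have "?F = (\<Union>n\<in>D. ?F \<inter> residue_class L n (\<rho> n))"
    using cover by (auto simp: residue_class_def)
  hence "card ?F \<le> (\<Sum>n\<in>D. card (?F \<inter> residue_class L n (\<rho> n)))"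
    using card_UN_le[OF D(1)] by metis
  also have "\<dots> = (\<Sum>n\<in>D. of_bool ([x = \<rho> n] (mod int (gcd M n))) * (L div lcm M n))"
    using D(2) M L by (intro sum.cong refl) (simp add: card_residue_class_Int)
  finally show ?thesis using card_residue_class[OF M L] by simp
qed

section \<open>Uncovered points and numbers of hits\<close>

lemma card_Int_eq_sum: "finite R \<Longrightarrow> card (R \<inter> A) = (\<Sum>x\<in>R. if x \<in> A then 1 else 0)"
  by (simp add: sum.If_cases)

lemma card_Int_two:
  assumes "finite R"
  shows "card (R \<inter> A) + card (R \<inter> B) + card (R - A - B) = card R + card (R \<inter> A \<inter> B)"
proof -
  have "card (R \<inter> A) + card (R \<inter> B) = card (R \<inter> A \<union> R \<inter> B) + card (R \<inter> A \<inter> B)"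
    using assms by (subst card_Un_Int) (auto intro!: arg_cong[of _ _ card])
  moreover have "card R = card (R \<inter> A \<union> R \<inter> B) + card (R - A - B)"
    using assms by (subst card_Un_disjoint[symmetric]) (auto intro!: arg_cong[of _ _ card])
  ultimately show ?thesis by simp
qed

text \<open>
  One Bonferroni-type bound: the union is built up starting from \<open>A j\<close>, so each intersection with
  \<open>A j\<close> is a saving over the sum of the sizes. For \<open>uncovered\<close> it means that overlaps between
  classes force extra uncovered points.
\<close>

lemma card_UN_star:
  assumes "finite J" "j \<in> J" "\<And>i. i \<in> J \<Longrightarrow> finite (A i)"
  shows "card (\<Union>i\<in>J. A i) + (\<Sum>i\<in>J - {j}. card (A i \<inter> A j)) \<le> (\<Sum>i\<in>J. card (A i))"
proof -
  have "(\<Union>i\<in>J. A i) = A j \<union> (\<Union>i\<in>J - {j}. A i - A j)" using assms by blast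
  hence "card (\<Union>i\<in>J. A i) \<le> card (A j) + card (\<Union>i\<in>J - {j}. A i - A j)"
    by (metis card_Un_le)
  also have "card (\<Union>i\<in>J - {j}. A i - A j) \<le> (\<Sum>i\<in>J - {j}. card (A i - A j))"
    using assms by (intro card_UN_le) auto
  finally have "card (\<Union>i\<in>J. A i) + (\<Sum>i\<in>J - {j}. card (A i \<inter> A j))
      \<le> card (A j) + (\<Sum>i\<in>J - {j}. card (A i - A j) + card (A i \<inter> A j))"
    by (simp add: sum.distrib)
  also have "(\<Sum>i\<in>J - {j}. card (A i - A j) + card (A i \<inter> A j)) = (\<Sum>i\<in>J - {j}. card (A i))"
    using assms by (intro sum.cong refl) (metis DiffD1 card_Diff_subset_Int Int_lower1 card_mono
      finite_Int le_add_diff_inverse2)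
  also have "card (A j) + \<dots> = (\<Sum>i\<in>J. card (A i))"
    using assms by (simp add: sum.remove)
  finally show ?thesis .
qed

definition uncovered :: "nat \<Rightarrow> nat set \<Rightarrow> (nat \<Rightarrow> int) \<Rightarrow> int set" where
  "uncovered M J a = {0..<int M} - (\<Union>n\<in>J. residue_class M n (a n))"

lemma finite_uncovered [simp]: "finite (uncovered M J a)"
  unfolding uncovered_def by simp

lemma card_uncovered_star:
  assumes "finite J" "j \<in> J" "\<And>n. n \<in> J \<Longrightarrow> n dvd M" "M > 0"
  shows "M + (\<Sum>i\<in>J - {j}. card (residue_class M i (a i) \<inter> residue_class M j (a j)))
    \<le> card (uncovered M J a) + (\<Sum>n\<in>J. M div n)"
proof -
  let ?A = "\<lambda>n. residue_class M n (a n)"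
  have "(\<Union>n\<in>J. ?A n) \<subseteq> {0..<int M}" by (auto simp: residue_class_def)
  hence "card (uncovered M J a) + card (\<Union>n\<in>J. ?A n) = M"
    unfolding uncovered_def using card_mono[of "{0..<int M}" "\<Union>n\<in>J. ?A n"]
    by (subst card_Diff_subset) (auto intro: finite_subset)
  moreover have "(\<Sum>n\<in>J. card (?A n)) = (\<Sum>n\<in>J. M div n)"
    using assms by (intro sum.cong refl card_residue_class) auto
  ultimately show ?thesis using card_UN_star[OF assms(1,2), of ?A] by simp
qed

lemma card_uncovered_pair:
  assumes "finite J" "i \<in> J" "j \<in> J" "i \<noteq> j" "\<And>n. n \<in> J \<Longrightarrow> n dvd M" "M > 0"
  shows "M + card (residue_class M i (a i) \<inter> residue_class M j (a j))
    \<le> card (uncovered M J a) + (\<Sum>n\<in>J. M div n)"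
proof -
  let ?f = "\<lambda>i. card (residue_class M i (a i) \<inter> residue_class M j (a j))"
  have "?f i \<le> (\<Sum>i\<in>J - {j}. ?f i)"
    using assms by (intro member_le_sum) auto
  thus ?thesis using card_uncovered_star[OF assms(1,3,5,6), of a] by linarith
qed

text \<open>A set that meets one of the covering classes is that much smaller inside the uncovered set.\<close>

lemma card_uncovered_Int:
  assumes "finite X" "i \<in> J"
  shows "card (uncovered M J a \<inter> X) + card (X \<inter> residue_class M i (a i)) \<le> card X"
proof -
  have "card (uncovered M J a \<inter> X) + card (X \<inter> residue_class M i (a i)) 
    = card (uncovered M J a \<inter> X \<union> X \<inter> residue_class M i (a i))"
    using assms by (intro card_Un_disjoint[symmetric]) (auto simp: uncovered_def)
  also have "\<dots> \<le> card X" using assms by (intro card_mono) auto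
  finally show ?thesis .
qed

lemma card_uncovered_Int2:
  assumes "finite X" "i \<in> J" "j \<in> J"
    "residue_class M i (a i) \<inter> residue_class M j (a j) = {}"
  shows "card (uncovered M J a \<inter> X) + card (X \<inter> residue_class M i (a i))
    + card (X \<inter> residue_class M j (a j)) \<le> card X"
proof -
  have "card (uncovered M J a \<inter> X) + card (X \<inter> residue_class M j (a j))
    = card (uncovered M J a \<inter> (X - residue_class M i (a i)))
     + card ((X - residue_class M i (a i)) \<inter> residue_class M j (a j))"
    using assms by (intro arg_cong2[of _ _ _ _ "(+)"] arg_cong[of _ _ card]) (auto simp: uncovered_def)
  also have "\<dots> \<le> card (X - residue_class M i (a i))"
    using assms by (intro card_uncovered_Int) auto
  also have "\<dots> = card X - card (X \<inter> residue_class M i (a i))"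
    using assms by (simp add: card_Diff_subset_Int)
  finally show ?thesis using card_mono[OF assms(1), of "X \<inter> residue_class M i (a i)"] by simp
qed

definition hits :: "nat set \<Rightarrow> (nat \<Rightarrow> int) \<Rightarrow> int \<Rightarrow> nat" where
  "hits D b x = (\<Sum>d\<in>D. of_bool ([x = b d] (mod int d)))"

text \<open>Double counting of the pairs of a point of \<open>R\<close> and a class through it.\<close>

lemma sum_hits:
  assumes "finite R" "R \<subseteq> {0..<int M}"
  shows "(\<Sum>x\<in>R. hits D b x) = (\<Sum>d\<in>D. card (R \<inter> residue_class M d (b d)))"
proof -
  have "(\<Sum>x\<in>R. hits D b x) = (\<Sum>d\<in>D. \<Sum>x\<in>R. of_bool ([x = b d] (mod int d)))"
    unfolding hits_def by (rule sum.swap)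
  also have "\<dots> = (\<Sum>d\<in>D. card (R \<inter> residue_class M d (b d)))"
    using assms by (intro sum.cong refl) (auto simp: of_bool_def sum.If_cases residue_class_def
        intro!: arg_cong[of _ _ card])
  finally show ?thesis .
qed

section \<open>Patterns modulo 36\<close>

lemma card_residue_classes_36:
  "d dvd 36 \<Longrightarrow> card (residue_class 36 d r) = 36 div d"
  "card (residue_class 36 2 r \<inter> residue_class 36 3 s) = 6"
  "card (residue_class 36 4 r \<inter> residue_class 36 3 s) = 3"
  "card (residue_class 36 4 r \<inter> residue_class 36 6 s) = (if even r \<longleftrightarrow> even s then 3 else 0)"
  "card (residue_class 36 6 r \<inter> residue_class 36 4 s) = (if even r \<longleftrightarrow> even s then 3 else 0)"
  "card (residue_class 36 9 r \<inter> residue_class 36 2 s) = 2"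
  "card (residue_class 36 4 r \<inter> residue_class 36 9 s) = 1"
  "card (residue_class 36 9 r \<inter> residue_class 36 4 s) = 1"
  by (simp_all add: card_residue_class card_residue_class_Int gcd_non_0_nat lcm_nat_def cong_2_iff_even)

text \<open>
  Suppose that the set \<open>A\<close> of points hit four times has \<open>n\<close> elements. Double counting gives
  \<open>4 * n\<close> as a lower bound for the sum of all \<open>card (A \<inter> C d)\<close>. A large share must come from
  \<open>C 4\<close> and \<open>C 9\<close>, but these compete: if \<open>C 4\<close> lies in \<open>C 2\<close>, then half of \<open>C 9\<close> lies outside \<open>C 2\<close>,
  hence outside \<open>C 4\<close>; otherwise \<open>C 4\<close> misses the well covered set \<open>C 2 \<inter> C 3\<close>.
\<close>

lemma card_hits_ge_4:
  assumes D: "D = {2,3,4,6,9,12,18,36}"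
  shows "card {x \<in> {0..<36}. 4 \<le> hits D b x} \<le> 8"
proof -
  define A where "A = {x \<in> {0..<36::int}. 4 \<le> hits D b x}"
  define C where "C d = residue_class 36 d (b d)" for d
  have [simp]: "finite A" by (rule finite_subset[of _ "{0..<36}"]) (auto simp: A_def)
  have [simp]: "finite (C d)" for d by (simp add: C_def)
  have le: "card (A \<inter> C d) \<le> 36 div d" if "d dvd 36" for d
    using card_mono[of "C d" "A \<inter> C d"] that by (simp add: C_def card_residue_classes_36)
  have two: "card (A \<inter> C 2) + card (A \<inter> C 3) + card (A - C 2 - C 3) = card A + card (A \<inter> C 2 \<inter> C 3)"
    by (rule card_Int_two) simp
  have "4 * card A \<le> (\<Sum>x\<in>A. hits D b x)"
    using sum_bounded_below[of A 4 "hits D b"] by (simp add: A_def mult.commute)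
  also have "\<dots> = (\<Sum>d\<in>D. card (A \<inter> C d))"
    unfolding C_def by (rule sum_hits) (simp, auto simp: A_def)
  \<comment> \<open>\<open>12\<close> is the total size of \<open>C 6\<close>, \<open>C 12\<close>, \<open>C 18\<close> and \<open>C 36\<close>\<close>
  finally have main: "3 * card A \<le> card (A \<inter> C 2 \<inter> C 3) + card (A \<inter> C 4) + card (A \<inter> C 9) + 12"
    using two le[of 6] le[of 12] le[of 18] le[of 36] by (simp add: D)
  have "card (A \<inter> C 4) + card (A \<inter> C 9) + card (A \<inter> C 2 \<inter> C 3) \<le> card A + 5"
  proof (cases "even (b 4) \<longleftrightarrow> even (b 2)")
    case True
    hence "C 4 \<subseteq> C 2" unfolding C_def by (intro residue_class_subset_parity) auto
    hence "A \<inter> C 4 \<subseteq> C 4 \<inter> C 3 \<union> (A \<inter> C 2 - C 3)" by blast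
    hence "card (A \<inter> C 4) \<le> card (C 4 \<inter> C 3) + card (A \<inter> C 2 - C 3)"
      by (meson card_mono card_Un_le le_trans finite_UnI finite_Int finite_Diff \<open>finite A\<close> \<open>finite (C _)\<close>)
    moreover have "card (A \<inter> C 9) \<le> card (C 9 \<inter> C 2) + card (A - C 2)"
      by (rule le_trans[OF card_mono card_Un_le]) auto
    moreover have "card A = card (A \<inter> C 2 \<inter> C 3) + card (A \<inter> C 2 - C 3) + card (A - C 2)"
      by (simp add: card_Int_Diff[of A "C 2"] card_Int_Diff[of "A \<inter> C 2" "C 3"])
    ultimately show ?thesis by (simp add: C_def card_residue_classes_36)
  next
    case False
    hence "C 4 \<inter> C 2 = {}" unfolding C_def by (intro residue_class_disjoint_parity) auto
    hence "card (A \<inter> C 4) + card (A \<inter> C 2 \<inter> C 3) = card (A \<inter> C 4 \<union> A \<inter> C 2 \<inter> C 3)"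
      by (subst card_Un_disjoint) auto
    also have "\<dots> \<le> card A" by (intro card_mono) auto
    finally show ?thesis using le[of 9] by simp
  qed
  with main have "card A \<le> 8" by linarith
  thus ?thesis by (simp add: A_def)
qed

text \<open>
  \<open>K n\<close> are the classes of the moduli \<open>n\<close> dividing \<open>36\<close>, \<open>R\<close> is what they leave uncovered, and \<open>C d\<close>
  are the classes modulo \<open>d\<close> in which the moduli \<open>5 * d\<close> hit. If the claim failed, then every
  point of \<open>R\<close> would be hit four times by the \<open>C d\<close>, up to a deficit of one on the small set \<open>A\<close>.
  The coprime pair \<open>K 4\<close>, \<open>K 9\<close> overlaps and also \<open>C 4\<close> meets \<open>K 9\<close> and \<open>C 9\<close> meets \<open>K 4\<close>; after
  these losses the count is tight up to a few points, and following the parities exhausts the rest.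
\<close>

lemma few_hits_outside_36:
  assumes J: "J = {4,6,9,12,18,36}" and D: "D = {2,3,4,6,9,12,18,36}"
  shows "\<exists>x\<in>uncovered 36 J a. 5 * hits D b x + hits D c x < 19"
proof (rule ccontr)
  define R where "R = uncovered 36 J a"
  define C where "C d = residue_class 36 d (b d)" for d
  define K where "K n = residue_class 36 n (a n)" for n
  define A where "A = {x \<in> {0..<36::int}. 4 \<le> hits D c x}"
  assume "\<not> (\<exists>x\<in>uncovered 36 J a. 5 * hits D b x + hits D c x < 19)"
  hence R: "19 \<le> 5 * hits D b x + hits D c x" if "x \<in> R" for x
    using that by (auto simp: R_def not_less)
  have [simp]: "finite R" by (simp add: R_def)
  have [simp]: "finite (C d)" "finite (K d)" for d by (simp_all add: C_def K_def)
  have R36: "R \<subseteq> {0..<36}" by (auto simp: R_def uncovered_def)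
  have A8: "card A \<le> 8" unfolding A_def by (rule card_hits_ge_4[OF D])
  have "finite A" by (rule finite_subset[of _ "{0..<36}"]) (auto simp: A_def)
  \<comment> \<open>as \<open>hits D c x \<le> 8\<close>, four hits fail only if there are exactly three, and then \<open>x\<close> is in \<open>A\<close>\<close>
  have pt: "4 \<le> hits D b x + (if x \<in> A then 1 else 0)" if "x \<in> R" for x
  proof -
    have "hits D c x \<le> (\<Sum>d\<in>D. 1)" unfolding hits_def by (intro sum_mono) auto
    hence "hits D c x \<le> 8" by (simp add: D)
    thus ?thesis using R[OF that] that R36 by (auto simp: A_def)
  qed
  have "4 * card R \<le> (\<Sum>x\<in>R. hits D b x + (if x \<in> A then 1 else 0))"
    using sum_bounded_below[of R 4, OF pt] by (simp add: mult.commute)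
  also have "\<dots> = (\<Sum>d\<in>D. card (R \<inter> C d)) + card (R \<inter> A)"
    using R36 by (simp add: sum.distrib card_Int_eq_sum sum_hits[of R 36] C_def)
  also have "card (R \<inter> A) \<le> 8"
    using card_mono[OF \<open>finite A\<close>, of "R \<inter> A"] A8 by simp
  finally have main: "4 * card R \<le> (\<Sum>d\<in>D. card (R \<inter> C d)) + 8" by simp
  have le: "card (R \<inter> C d) \<le> 36 div d" if "d dvd 36" for d
    using card_mono[of "C d" "R \<inter> C d"] that by (simp add: C_def card_residue_classes_36)
  have two: "card (R \<inter> C 2) + card (R \<inter> C 3) + card (R - C 2 - C 3) = card R + card (R \<inter> C 2 \<inter> C 3)"
    by (rule card_Int_two) simp
  have avoid: "card (R \<inter> X) + card (X \<inter> K n) \<le> card X" if "n \<in> J" "finite X" for X n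
    unfolding R_def K_def using that by (intro card_uncovered_Int)
  have dvd: "n dvd 36" if "n \<in> J" for n using that by (auto simp: J)
  have star: "36 + card (K 6 \<inter> K 4) + card (K 9 \<inter> K 4) \<le> card R + 25"
    using card_uncovered_star[of J 4 36 a] dvd by (simp add: J R_def K_def)
  have C9: "card (R \<inter> C 9) \<le> 3"
    using avoid[of 4 "C 9"] by (simp add: J C_def K_def card_residue_classes_36)
  have C4: "card (R \<inter> C 4) \<le> 8"
    using avoid[of 9 "C 4"] by (simp add: J C_def K_def card_residue_classes_36)
  \<comment> \<open>\<open>23\<close> is the sum of \<open>3\<close> for \<open>C 9\<close>, the sizes \<open>6\<close>, \<open>3\<close>, \<open>2\<close>, \<open>1\<close> of \<open>C 6\<close>, \<open>C 12\<close>, \<open>C 18\<close>, \<open>C 36\<close>,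
    and \<open>8\<close> for \<open>A\<close>\<close>
  have *: "3 * card R + card (R - C 2 - C 3) \<le>
      card (R \<inter> C 2 \<inter> C 3) + card (R \<inter> C 4) + 23"
    using main two le[of 6] C9 le[of 12] le[of 18] le[of 36] by (simp add: D)
  have r: "12 \<le> card R" using star by (simp add: K_def card_residue_classes_36)
  have P6: "card (C 2 \<inter> C 3) = 6" by (simp add: C_def card_residue_classes_36)
  have "card (R \<inter> (C 2 \<inter> C 3)) \<le> card (C 2 \<inter> C 3)" by (intro card_mono) auto
  hence P: "card (R \<inter> C 2 \<inter> C 3) \<le> 6" by (simp add: P6 Int_assoc)
  \<comment> \<open>otherwise \<open>K 4\<close> removes half of \<open>C 2 \<inter> C 3\<close>\<close>
  have k4: "even (a 4) \<noteq> even (b 2)"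
  proof
    assume eq: "even (a 4) = even (b 2)"
    obtain t where "even t = even (b 2)" "C 2 \<inter> C 3 = residue_class 36 6 t"
      unfolding C_def by (rule residue_class_2_Int_3)
    hence "card (C 2 \<inter> C 3 \<inter> K 4) = 3" using eq by (simp add: K_def card_residue_classes_36)
    hence "card (R \<inter> C 2 \<inter> C 3) \<le> 3" using avoid[of 4 "C 2 \<inter> C 3"] P6 by (simp add: J Int_assoc)
    with * r C4 show False by linarith
  qed
  \<comment> \<open>otherwise \<open>C 4\<close> lies outside \<open>C 2\<close>, and its points outside \<open>C 3\<close> are among those hit neither by
    \<open>C 2\<close> nor by \<open>C 3\<close>, which count against the inequality\<close>
  have c4: "even (b 4) = even (b 2)"
  proof (rule ccontr)
    assume "even (b 4) \<noteq> even (b 2)"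
    hence "C 4 \<inter> C 2 = {}" unfolding C_def by (intro residue_class_disjoint_parity) auto
    hence "R \<inter> C 4 \<subseteq> C 4 \<inter> C 3 \<union> (R - C 2 - C 3)" by blast
    hence "card (R \<inter> C 4) \<le> card (C 4 \<inter> C 3) + card (R - C 2 - C 3)"
      by (rule le_trans[OF card_mono card_Un_le, rotated]) auto
    hence "card (R \<inter> C 4) \<le> 3 + card (R - C 2 - C 3)"
      by (simp add: C_def card_residue_classes_36)
    with * r P show False by linarith
  qed
  show False
  proof (cases "even (a 6) = even (a 4)")
    case True
    \<comment> \<open>\<open>K 6\<close> and \<open>K 9\<close> both overlap \<open>K 4\<close>, so \<open>R\<close> has at least \<open>15\<close> points\<close>
    with star * P C4 show False by (simp add: K_def card_residue_classes_36)
  next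
    case False
    \<comment> \<open>now \<open>K 6\<close> meets \<open>C 4\<close> in three points\<close>
    with k4 c4 have "even (b 4) = even (a 6)" by blast
    hence "card (R \<inter> C 4) \<le> 6" using avoid[of 6 "C 4"]
      by (simp add: J C_def K_def card_residue_classes_36)
    with * r P show False by linarith
  qed
qed

section \<open>Patterns modulo 48\<close>

lemma card_residue_classes_48:
  "d dvd 48 \<Longrightarrow> card (residue_class 48 d r) = 48 div d"
  "d dvd 48 \<Longrightarrow> e dvd 48 \<Longrightarrow> card (residue_class 48 d r \<inter> residue_class 48 e s) =
    (if [r = s] (mod int (gcd d e)) then 48 div lcm d e else 0)"
  by (simp_all add: card_residue_class card_residue_class_Int)

lemma third_class_mod_3:
  fixes x y z p :: int
  assumes "\<not> [x = z] (mod 3)" "\<not> [y = z] (mod 3)" "\<not> [p = z] (mod 3)"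
    "\<not> [p = x] (mod 3)" "\<not> [p = y] (mod 3)"
  shows "[x = y] (mod 3)"
proof -
  have "u mod 3 \<in> {0, 1, 2}" for u :: int by (simp, presburger)
  moreover have "X = Y" if "X \<noteq> Z" "Y \<noteq> Z" "P \<noteq> Z" "P \<noteq> X" "P \<noteq> Y"
      "X \<in> {0, 1, 2}" "Y \<in> {0, 1, 2}" "Z \<in> {0, 1, 2}" "P \<in> {0, 1, 2}" for X Y Z P :: int
    using that by auto
  ultimately show ?thesis using assms unfolding cong_def by blast
qed

text \<open>
  With \<open>K n\<close>, \<open>R\<close> and \<open>C d\<close> as modulo \<open>36\<close>, four hits everywhere on \<open>R\<close> would give the inequality
  \<open>*\<close> below, in which \<open>nP\<close> and \<open>nT\<close> count the points of \<open>R\<close> in both and in neither of \<open>C 2\<close> and \<open>C 3\<close>.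
  If the \<open>K n\<close> are pairwise disjoint, then \<open>R\<close> has \<open>12\<close> points and each overlap adds to this.
  Since \<open>K 6\<close> meets every class modulo a power of two of its own parity, disjointness drives \<open>K 4\<close>,
  \<open>K 8\<close> and \<open>K 16\<close> into the other parity, which they almost fill. To hit often enough, the \<open>C d\<close> must
  then use the parity of \<open>K 6\<close>, where \<open>K 6\<close> takes its share of them. In the end \<open>K 6\<close>, \<open>C 3\<close> and the pair
  \<open>K 12\<close>, \<open>K 24\<close> occupy the three residues modulo \<open>3\<close> of this parity, and \<open>C 4\<close> loses too many points.
\<close>

lemma few_hits_outside_48:
  assumes J: "J = {4,6,8,12,16,24,48}" and D: "D = {2,3,4,6,8,12,16,24,48}"
  shows "\<exists>x\<in>uncovered 48 J a. hits D b x < 4"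
proof (rule ccontr)
  define R where "R = uncovered 48 J a"
  define C where "C d = residue_class 48 d (b d)" for d
  define K where "K n = residue_class 48 n (a n)" for n
  assume "\<not> (\<exists>x\<in>uncovered 48 J a. hits D b x < 4)"
  hence pt: "4 \<le> hits D b x" if "x \<in> R" for x
    using that by (auto simp: R_def not_less)
  have [simp]: "finite R" by (simp add: R_def)
  have [simp]: "finite (C d)" "finite (K d)" for d by (simp_all add: C_def K_def)
  have R48: "R \<subseteq> {0..<48}" by (auto simp: R_def uncovered_def)
  have "4 * card R \<le> (\<Sum>x\<in>R. hits D b x)"
    using sum_bounded_below[of R 4, OF pt] by (simp add: mult.commute)
  also have "\<dots> = (\<Sum>d\<in>D. card (R \<inter> C d))"
    unfolding C_def using R48 by (intro sum_hits) auto
  finally have main: "4 * card R \<le> (\<Sum>d\<in>D. card (R \<inter> C d))" .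
  have le: "card (R \<inter> C d) \<le> 48 div d" if "d dvd 48" for d
    using card_mono[of "C d" "R \<inter> C d"] that by (simp add: C_def card_residue_classes_48)
  have two: "card (R \<inter> C 2) + card (R \<inter> C 3) + card (R - C 2 - C 3) = card R + card (R \<inter> C 2 \<inter> C 3)"
    by (rule card_Int_two) simp
  define r where "r = card R"
  define nP where "nP = card (R \<inter> C 2 \<inter> C 3)"
  define nT where "nT = card (R - C 2 - C 3)"
  \<comment> \<open>\<open>15\<close> is the total size of \<open>C 6\<close>, \<open>C 12\<close>, \<open>C 24\<close> and \<open>C 48\<close>\<close>
  have *: "3 * r + nT \<le> nP + card (R \<inter> C 4) + card (R \<inter> C 8) + card (R \<inter> C 16) + 15"
    using main two le[of 6] le[of 12] le[of 24] le[of 48] by (simp add: D r_def nP_def nT_def)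
  have avoid: "card (R \<inter> X) + card (X \<inter> K n) \<le> card X" if "n \<in> J" "finite X" for X n
    unfolding R_def K_def using that by (intro card_uncovered_Int)
  have avoid2: "card (R \<inter> X) + card (X \<inter> K m) + card (X \<inter> K n) \<le> card X"
    if "m \<in> J" "n \<in> J" "card (K m \<inter> K n) = 0" "finite X" for X m n
    unfolding R_def K_def using that by (intro card_uncovered_Int2) (simp_all add: K_def)
  have dvd: "n dvd 48" if "n \<in> J" for n using that by (auto simp: J)
  have pair: "12 + card (K m \<inter> K n) \<le> r" if "m \<in> J" "n \<in> J" "m \<noteq> n" for m n
    using card_uncovered_pair[of J m n 48 a] dvd that by (simp add: J R_def r_def K_def)
  have KK: "card (K m \<inter> K n) = (if [a m = a n] (mod int (gcd m n)) then 48 div lcm m n else 0)"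
    if "m \<in> J" "n \<in> J" for m n
    using that dvd by (simp add: K_def card_residue_classes_48)
  have CK: "card (C d \<inter> K n) = (if [b d = a n] (mod int (gcd d n)) then 48 div lcm d n else 0)"
    if "d dvd 48" "n \<in> J" for d n
    using that dvd by (simp add: K_def C_def card_residue_classes_48)
  have r12: "12 \<le> r" using pair[of 4 6] by (simp add: J)
  obtain p where p2: "even p = even (b 2)" and P: "C 2 \<inter> C 3 = residue_class 48 6 p"
    unfolding C_def by (rule residue_class_2_Int_3)
  have P_avoid: "nP + card (residue_class 48 6 p \<inter> K n) \<le> 8" if "n \<in> J" for n
    using avoid[OF that, of "residue_class 48 6 p"]
    by (simp add: nP_def P Int_assoc card_residue_classes_48)
  have nP8: "nP \<le> 8" using P_avoid[of 4] by (simp add: J)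
  \<comment> \<open>A class disjoint from \<open>C 2\<close> gains little: its points outside \<open>C 3\<close> raise \<open>nT\<close>, which stands on
    the other side of \<open>*\<close>.\<close>
  have off_C2: "card (R \<inter> C d) \<le> card (R \<inter> (C d \<inter> C 3)) + nT" if "even d" "even (b d) \<noteq> even (b 2)" for d
  proof -
    have "C d \<inter> C 2 = {}" unfolding C_def using that by (intro residue_class_disjoint_parity) auto
    hence "R \<inter> C d \<subseteq> R \<inter> (C d \<inter> C 3) \<union> (R - C 2 - C 3)" by blast
    thus ?thesis unfolding nT_def
      by (rule le_trans[OF card_mono card_Un_le, rotated]) auto
  qed
  have C3: "card (C d \<inter> C 3) = 48 div lcm d 3" if "d dvd 48" "gcd d 3 = 1" for d
    using that by (simp add: C_def card_residue_classes_48)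
  have C16: "card (R \<inter> C 16) \<le> 3" using le[of 16] by simp
  have C8: "card (R \<inter> C 8) \<le> 6" using le[of 8] by simp
  have C4: "card (R \<inter> C 4) \<le> 12" using le[of 4] by simp

  \<comment> \<open>Overlaps among the \<open>K n\<close> raise \<open>r\<close> beyond what \<open>*\<close> permits, which excludes them one by one.\<close>
  have k4: "even (a 4) \<noteq> even (a 6)"
  proof
    assume "even (a 4) = even (a 6)"
    hence "card (K 4 \<inter> K 6) = 4"
      using KK[of 4 6] by (simp add: J gcd_lcm_numeral cong_2_iff_even)
    thus False using pair[of 4 6] * C4 C8 C16 nP8 by (simp add: J)
  qed
  have k8_4: "\<not> [a 8 = a 4] (mod 4)"
    using pair[of 8 4] KK[of 8 4] * C4 C8 C16 nP8
    by (auto simp: J gcd_lcm_numeral cong_2_iff_even)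
  have k8_6: "r \<ge> 14" if "even (a 8) = even (a 6)"
    using pair[of 8 6] KK[of 8 6] that
    by (auto simp: J gcd_lcm_numeral cong_2_iff_even)
  have halves4: "[x = z] (mod 4)" if "\<not> [x = y] (mod 4)" "\<not> [z = y] (mod 4)"
      "even x = even y" "even z = even y" for x y z :: int
    using cong_halves[of x y 2 z] that by (simp add: cong_2_iff_even)
  have halves8: "[x = z] (mod 8)" if "\<not> [x = y] (mod 8)" "\<not> [z = y] (mod 8)"
      "[x = y] (mod 4)" "[z = y] (mod 4)" for x y z :: int
    using cong_halves[of x y 4 z] that by simp
  \<comment> \<open>If \<open>C 4\<close> were in the parity opposite to \<open>K 6\<close>, it would be the half of it left by \<open>K 4\<close>, and \<open>K 8\<close>
    would either overlap \<open>K 6\<close> or lie inside \<open>C 4\<close>.\<close>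
  have c4: "even (b 4) = even (a 6)"
  proof (rule ccontr)
    assume c4: "even (b 4) \<noteq> even (a 6)"
    have c4k4: "\<not> [b 4 = a 4] (mod 4)"
      using avoid[of 4 "C 4"] CK[of 4 4] * C8 C16 nP8 r12
      by (auto simp: J C_def card_residue_classes_48 gcd_lcm_numeral)
    have k8c4: "[a 8 = b 4] (mod 4)" if "even (a 8) \<noteq> even (a 6)"
      using halves4[of "a 8" "a 4" "b 4"] k8_4 c4k4 c4 k4 that by blast
    show False
    proof (cases "even (b 2) = even (a 6)")
      case True
      have "card (R \<inter> C 4) \<le> card (R \<inter> (C 4 \<inter> C 3)) + nT"
        using off_C2[of 4] c4 True by simp
      moreover have "card (R \<inter> (C 4 \<inter> C 3)) + card (C 4 \<inter> C 3 \<inter> K 8) \<le> 4"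
        using avoid[of 8 "C 4 \<inter> C 3"] by (simp add: J C3 gcd_lcm_numeral)
      moreover have "card (C 4 \<inter> C 3 \<inter> K 8) = 2" if "even (a 8) \<noteq> even (a 6)"
      proof -
        have "K 8 \<subseteq> C 4" unfolding K_def C_def using k8c4[OF that]
          by (intro residue_class_mono) auto
        hence "C 4 \<inter> C 3 \<inter> K 8 = C 3 \<inter> K 8" by blast
        thus ?thesis using CK[of 3 8] by (simp add: J gcd_lcm_numeral)
      qed
      ultimately show False using * C8 C16 nP8 r12 k8_6 by linarith
    next
      case False
      have "nP \<le> 4" using P_avoid[of 4] p2 False k4 
        by (simp add: J K_def card_residue_classes_48 gcd_lcm_numeral cong_2_iff_even split: if_splits)
      moreover have "card (R \<inter> C 4) \<le> 6" if "even (a 8) \<noteq> even (a 6)"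
        using avoid[of 8 "C 4"] CK[of 4 8] k8c4[OF that]
        by (simp add: J C_def card_residue_classes_48 gcd_lcm_numeral cong_sym)
      ultimately show False using * C4 C8 C16 k8_6 r12 by linarith
    qed
  qed
  have C4': "card (R \<inter> C 4) \<le> 8"
    using avoid[of 6 "C 4"] CK[of 4 6] c4
    by (simp add: J C_def card_residue_classes_48 gcd_lcm_numeral cong_2_iff_even)
  hence r13: "r \<le> 13" using * C8 C16 nP8 by linarith
  hence k8: "even (a 8) \<noteq> even (a 6)" using k8_6 by force
  have k16_4: "\<not> [a 16 = a 4] (mod 4)"
    using pair[of 16 4] KK[of 16 4] r13 by (auto simp: J gcd_lcm_numeral)
  have k16_8: "\<not> [a 16 = a 8] (mod 8)"
    using pair[of 16 8] KK[of 16 8] r13 by (auto simp: J gcd_lcm_numeral)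
  have k16_6: "r = 13" if "even (a 16) = even (a 6)"
    using pair[of 16 6] KK[of 16 6] r13 that by (auto simp: J gcd_lcm_numeral cong_2_iff_even)
  \<comment> \<open>otherwise \<open>K 4\<close> and \<open>K 8\<close> would remove \<open>6\<close> of the \<open>8\<close> points of \<open>C 2 \<inter> C 3\<close>\<close>
  have c2: "even (b 2) = even (a 6)"
  proof (rule ccontr)
    assume ne: "even (b 2) \<noteq> even (a 6)"
    have "nP + card (residue_class 48 6 p \<inter> K 4) + card (residue_class 48 6 p \<inter> K 8) \<le> 8"
      using avoid2[of 4 8 "residue_class 48 6 p"] KK[of 4 8] k8_4
      by (simp add: nP_def P Int_assoc J card_residue_classes_48 gcd_lcm_numeral cong_sym_eq)
    hence "nP \<le> 2" using p2 ne k4 k8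
      by (simp add: K_def card_residue_classes_48 gcd_lcm_numeral cong_2_iff_even split: if_splits)
    thus False using * C4' C8 C16 r12 by linarith
  qed
  \<comment> \<open>otherwise \<open>C 8\<close> would be the class modulo \<open>8\<close> left by \<open>K 4\<close> and \<open>K 8\<close> in their parity, which
    contains \<open>K 16\<close>\<close>
  have c8: "even (b 8) = even (a 6)"
  proof (rule ccontr)
    assume ne: "even (b 8) \<noteq> even (a 6)"
    have "card (R \<inter> C 8) \<le> card (R \<inter> (C 8 \<inter> C 3)) + nT"
      using off_C2[of 8] ne c2 by simp
    moreover have "card (R \<inter> (C 8 \<inter> C 3)) \<le> 2"
      using avoid[of 8 "C 8 \<inter> C 3"] by (simp add: J C3 gcd_lcm_numeral)
    ultimately have "r = 12" using * C4' C16 nP8 r12 by linarith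
    hence k16: "even (a 16) \<noteq> even (a 6)" using k16_6 by force
    have "\<not> [b 8 = a 4] (mod 4)"
      using avoid[of 4 "C 8"] CK[of 8 4] * C4' C16 nP8 r12
      by (auto simp: J C_def card_residue_classes_48 gcd_lcm_numeral)
    moreover have c8k8: "\<not> [b 8 = a 8] (mod 8)"
      using avoid[of 8 "C 8"] CK[of 8 8] * C4' C16 nP8 r12
      by (auto simp: J C_def card_residue_classes_48 gcd_lcm_numeral)
    ultimately have "[b 8 = a 8] (mod 4)"
      using halves4[of "b 8" "a 4" "a 8"] k8_4 ne k8 k4 by blast
    moreover have "[a 16 = a 8] (mod 4)"
      using halves4[of "a 16" "a 4" "a 8"] k8_4 k16_4 k16 k8 k4 by blast
    ultimately have "[a 16 = b 8] (mod 8)"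
      using halves8[of "a 16" "a 8" "b 8"] k16_8 c8k8 by blast
    hence "K 16 \<subseteq> C 8" unfolding K_def C_def by (intro residue_class_mono) auto
    hence "C 8 \<inter> C 3 \<inter> K 16 = C 3 \<inter> K 16" by blast
    hence "card (C 8 \<inter> C 3 \<inter> K 16) = 1" using CK[of 3 16] by (simp add: J gcd_lcm_numeral)
    hence "card (R \<inter> (C 8 \<inter> C 3)) \<le> 1"
      using avoid[of 16 "C 8 \<inter> C 3"] by (simp add: J C3 gcd_lcm_numeral)
    with \<open>card (R \<inter> C 8) \<le> card (R \<inter> (C 8 \<inter> C 3)) + nT\<close>
    show False using * C4' C16 nP8 r12 by linarith
  qed
  have C8': "card (R \<inter> C 8) \<le> 4"
    using avoid[of 6 "C 8"] CK[of 8 6] c8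
    by (simp add: J C_def card_residue_classes_48 gcd_lcm_numeral cong_2_iff_even)
  hence r: "r = 12" using * C4' C16 nP8 r12 by linarith
  hence k16: "even (a 16) \<noteq> even (a 6)" using k16_6 by force
  \<comment> \<open>The bound \<open>r \<ge> 12\<close> is attained, so from here on the \<open>K n\<close> are pairwise disjoint.\<close>
  have disjoint: "card (K m \<inter> K n) = 0" if "m \<in> J" "n \<in> J" "m \<noteq> n" for m n
    using pair[OF that] r by simp
  have not_cong: "\<not> [a m = a n] (mod int (gcd m n))" if "m \<in> J" "n \<in> J" "m \<noteq> n" for m n
  proof -
    have "lcm m n dvd 48" using that dvd by simp
    hence "48 div lcm m n \<noteq> 0" by (auto simp: dvd_div_eq_0_iff)
    thus ?thesis using disjoint[OF that] KK[OF that(1,2)] by auto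
  qed
  have C16': "card (R \<inter> C 16) \<le> 2 + nT"
  proof (cases "even (b 16) = even (a 6)")
    case True
    thus ?thesis using avoid[of 6 "C 16"] CK[of 16 6]
      by (simp add: J C_def card_residue_classes_48 gcd_lcm_numeral cong_2_iff_even)
  next
    case False
    have "card (R \<inter> (C 16 \<inter> C 3)) \<le> card (C 16 \<inter> C 3)" by (intro card_mono) auto
    also have "\<dots> = 1" by (simp add: C3 gcd_lcm_numeral)
    finally show ?thesis using off_C2[of 16] False c2 by simp
  qed
  \<comment> \<open>so at most one point of \<open>C 2 \<inter> C 3\<close> is lost, and no \<open>K n\<close> with \<open>n\<close> in \<open>{6, 12, 24}\<close> lies in it\<close>
  have nP7: "7 \<le> nP" using * C4' C8' C16' r by linarith
  have P_K: "card (residue_class 48 6 p \<inter> K n) \<le> 1" if "n \<in> J" for n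
    using P_avoid[OF that] nP7 by simp
  have pk: "\<not> [p = a n] (mod 6)" if "n = 6 \<or> n = 12 \<or> n = 24" for n
    using P_K[of n] that by (auto simp: J K_def card_residue_classes_48 gcd_lcm_numeral)
  have mod6: "[x = y] (mod 6) \<longleftrightarrow> [x = y] (mod 3) \<and> even x = even y" for x y :: int
  proof -
    have "6 dvd z \<longleftrightarrow> 3 dvd z \<and> 2 dvd z" for z :: int by presburger
    thus ?thesis unfolding cong_2_iff_even[symmetric] cong_iff_dvd_diff by blast
  qed
  \<comment> \<open>\<open>K 4\<close>, \<open>K 8\<close> and \<open>K 16\<close> leave no room for \<open>K 12\<close> or \<open>K 24\<close> in their parity.\<close>
  have k12: "even (a 12) = even (a 6)"
  proof (rule ccontr)
    assume "even (a 12) \<noteq> even (a 6)"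
    moreover have "\<not> [a 12 = a 4] (mod 4)" "\<not> [a 12 = a 8] (mod 4)"
      using not_cong[of 12 4] not_cong[of 12 8] by (simp_all add: J gcd_lcm_numeral)
    ultimately show False using halves4[of "a 12" "a 4" "a 8"] k8_4 k8 k4 by blast
  qed
  have k24: "even (a 24) = even (a 6)"
  proof (rule ccontr)
    assume ne: "even (a 24) \<noteq> even (a 6)"
    have n: "\<not> [a 24 = a 4] (mod 4)" "\<not> [a 24 = a 8] (mod 8)" "\<not> [a 24 = a 16] (mod 8)"
      using not_cong[of 24 4] not_cong[of 24 8] not_cong[of 24 16] by (simp_all add: J gcd_lcm_numeral)
    have "[a 24 = a 8] (mod 4)" "[a 16 = a 8] (mod 4)"
      using halves4[of _ "a 4" "a 8"] n k8_4 k16_4 k16 k8 k4 ne by blast+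
    thus False using halves8[of "a 24" "a 8" "a 16"] n k16_8 by blast
  qed
  have "\<not> [a 12 = a 6] (mod 3)" "\<not> [a 24 = a 6] (mod 3)" "\<not> [p = a 6] (mod 3)"
      "\<not> [p = a 12] (mod 3)" "\<not> [p = a 24] (mod 3)"
    using not_cong[of 12 6] not_cong[of 24 6] pk[of 6] pk[of 12] pk[of 24] k12 k24 p2 c2
    by (simp_all add: J gcd_lcm_numeral mod6)
  hence k24_12: "[a 24 = a 12] (mod 3)" using third_class_mod_3 by blast
  have "\<not> [a 24 = a 12] (mod 12)" using not_cong[of 24 12] by (simp add: J gcd_lcm_numeral)
  hence k24_12': "\<not> [a 24 = a 12] (mod 4)"
    using k24_12 coprime_cong_mult[of "a 24" "a 12" 3 4] by (auto simp: coprime_iff_gcd_eq_1 gcd_non_0_int)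
  \<comment> \<open>\<open>K 12\<close> and \<open>K 24\<close> agree modulo \<open>3\<close>, hence differ modulo \<open>4\<close>; so one of them lies inside \<open>C 4\<close>,
    of which \<open>K 6\<close> takes another third.\<close>
  have "card (R \<inter> C 4) \<le> 6"
  proof (cases "[b 4 = a 12] (mod 4)")
    case True
    thus ?thesis
      using avoid2[of 6 12 "C 4"] CK[of 4 6] CK[of 4 12] disjoint[of 6 12] c4
      by (simp add: J C_def card_residue_classes_48 gcd_lcm_numeral cong_2_iff_even)
  next
    case False
    hence "[b 4 = a 24] (mod 4)"
      using halves4[of "b 4" "a 12" "a 24"] k24_12' c4 k12 k24 by blast
    thus ?thesis
      using avoid2[of 6 24 "C 4"] CK[of 4 6] CK[of 4 24] disjoint[of 6 24] c4
      by (simp add: J C_def card_residue_classes_48 gcd_lcm_numeral cong_2_iff_even)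
  qed
  with * C8' C16' nP8 r show False by linarith
qed

section \<open>No covers with moduli dividing 900 or 240\<close>

lemma divisors_2_3_5:
  fixes n :: nat
  assumes "n dvd 2 ^ a * (3 ^ b * 5 ^ c)"
  shows "\<exists>i\<le>a. \<exists>j\<le>b. \<exists>k\<le>c. n = 2 ^ i * (3 ^ j * 5 ^ k)"
proof -
  obtain x v where x: "n = x * v" "x dvd 2 ^ a" and v: "v dvd 3 ^ b * 5 ^ c"
    using division_decomp[OF assms] by blast
  obtain y z where y: "v = y * z" "y dvd 3 ^ b" "z dvd 5 ^ c"
    using division_decomp[OF v] by blast
  have "prime (2::nat)" "prime (3::nat)" "prime (5::nat)" by simp_all
  hence "\<exists>i\<le>a. x = 2 ^ i" "\<exists>j\<le>b. y = 3 ^ j" "\<exists>k\<le>c. z = 5 ^ k"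
    using x(2) y(2,3) by (simp_all add: divides_primepow_nat)
  with x(1) y(1) show ?thesis by blast
qed

lemma divisors_900:
  assumes "n dvd 900" "4 \<le> n"
  shows "n \<in> {4,6,9,12,18,36, 5,10,15,20,30,45,60,90,180, 25,50,75,100,150,225,300,450,900::nat}"
proof -
  obtain i j k where n: "i \<le> 2" "j \<le> 2" "k \<le> 2" "n = 2 ^ i * (3 ^ j * 5 ^ k)"
    using divisors_2_3_5[of n 2 2 2] assms(1) by auto
  have "i = 0 \<or> i = 1 \<or> i = 2" "j = 0 \<or> j = 1 \<or> j = 2" "k = 0 \<or> k = 1 \<or> k = 2"
    using n(1-3) by arith+
  thus ?thesis using n(4) assms(2) by (elim disjE) simp_all
qed

lemma divisors_240:
  assumes "n dvd 240" "4 \<le> n"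
  shows "n \<in> {4,6,8,12,16,24,48, 5,10,15,20,30,40,60,80,120,240::nat}"
proof -
  obtain i j k where n: "i \<le> 4" "j \<le> 1" "k \<le> 1" "n = 2 ^ i * (3 ^ j * 5 ^ k)"
    using divisors_2_3_5[of n 4 1 1] assms(1) by auto
  have "i = 0 \<or> i = 1 \<or> i = 2 \<or> i = 3 \<or> i = 4" "j = 0 \<or> j = 1" "k = 0 \<or> k = 1"
    using n(1-3) by arith+
  thus ?thesis using n(4) assms(2) by (elim disjE) simp_all
qed

text \<open>
  A modulus \<open>n\<close> dividing \<open>36\<close> fills the whole fibre of \<open>25\<close> points or none of it, the moduli \<open>5 * d\<close>
  and \<open>25 * d\<close> with \<open>d\<close> dividing \<open>36\<close> contribute \<open>5\<close> points and \<open>1\<close> point. The moduli \<open>5\<close> and \<open>25\<close>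
  hit every fibre, which leaves \<open>19\<close> points to the others.
\<close>

lemma no_cover_900:
  assumes "\<And>y::int. \<exists>n. n dvd 900 \<and> 4 \<le> n \<and> [y = \<rho> n] (mod int n)"
  shows False
proof -
  let ?J = "{4,6,9,12,18,36::nat}" and ?D = "{2,3,4,6,9,12,18,36::nat}"
  let ?N = "{4,6,9,12,18,36, 5,10,15,20,30,45,60,90,180, 25,50,75,100,150,225,300,450,900::nat}"
  obtain x where x: "x \<in> uncovered 36 ?J \<rho>"
    and few: "5 * hits ?D (\<lambda>d. \<rho> (5 * d)) x + hits ?D (\<lambda>d. \<rho> (25 * d)) x < 19"
    using few_hits_outside_36[OF refl refl] by blast
  have cover: "\<exists>n\<in>?N. [y = \<rho> n] (mod int n)" for y
    using assms[of y] divisors_900 by blast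
  have dvd: "n dvd 900" if "n \<in> ?N" for n using that by auto
  have "900 div 36 \<le> (\<Sum>n\<in>?N. of_bool ([x = \<rho> n] (mod int (gcd 36 n))) * (900 div lcm 36 n))"
    by (rule fibre_inequality[OF cover _ dvd]) simp_all
  moreover have "\<not> [x = \<rho> n] (mod int n)" if "n \<in> ?J" for n
    using x that by (auto simp: uncovered_def residue_class_def)
  hence "\<not> [x = \<rho> 4] (mod 4)" "\<not> [x = \<rho> 6] (mod 6)" "\<not> [x = \<rho> 9] (mod 9)"
    "\<not> [x = \<rho> 12] (mod 12)" "\<not> [x = \<rho> 18] (mod 18)" "\<not> [x = \<rho> 36] (mod 36)" by force+
  ultimately show False using few by (simp add: hits_def gcd_lcm_numeral
      del: sum_of_bool_eq sum_mult_of_bool_eq sum_of_bool_mult_eq)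
qed

lemma no_cover_240:
  assumes "\<And>y::int. \<exists>n. n dvd 240 \<and> 4 \<le> n \<and> [y = \<rho> n] (mod int n)"
  shows False
proof -
  let ?J = "{4,6,8,12,16,24,48::nat}" and ?D = "{2,3,4,6,8,12,16,24,48::nat}"
  let ?N = "{4,6,8,12,16,24,48, 5,10,15,20,30,40,60,80,120,240::nat}"
  obtain x where x: "x \<in> uncovered 48 ?J \<rho>" and few: "hits ?D (\<lambda>d. \<rho> (5 * d)) x < 4"
    using few_hits_outside_48[OF refl refl] by blast
  have cover: "\<exists>n\<in>?N. [y = \<rho> n] (mod int n)" for y
    using assms[of y] divisors_240 by blast
  have dvd: "n dvd 240" if "n \<in> ?N" for n using that by auto
  have "240 div 48 \<le> (\<Sum>n\<in>?N. of_bool ([x = \<rho> n] (mod int (gcd 48 n))) * (240 div lcm 48 n))"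
    by (rule fibre_inequality[OF cover _ dvd]) simp_all
  moreover have "\<not> [x = \<rho> n] (mod int n)" if "n \<in> ?J" for n
    using x that by (auto simp: uncovered_def residue_class_def)
  hence "\<not> [x = \<rho> 4] (mod 4)" "\<not> [x = \<rho> 6] (mod 6)" "\<not> [x = \<rho> 8] (mod 8)"
    "\<not> [x = \<rho> 12] (mod 12)" "\<not> [x = \<rho> 16] (mod 16)" "\<not> [x = \<rho> 24] (mod 24)"
    "\<not> [x = \<rho> 48] (mod 48)" by force+
  ultimately show False using few by (simp add: hits_def gcd_lcm_numeral
      del: sum_of_bool_eq sum_mult_of_bool_eq sum_of_bool_mult_eq)
qed

text \<open>
  Distinct moduli make a covering system a choice of one residue \<open>\<rho> n\<close> for each modulus, and residues
  for unused moduli do no harm; so only the set of admissible moduli matters.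
\<close>

lemma covering_moduli:
  assumes C: "distinct_covering_system C" and "least_modulus C = 4" and "lcm_moduli C dvd L"
  obtains \<rho> where "\<And>y::int. \<exists>n. n dvd L \<and> 4 \<le> n \<and> [y = \<rho> n] (mod int n)"
proof
  define \<rho> where "\<rho> n = (SOME r. (r, n) \<in> C)" for n
  fix y :: int
  have inj: "inj_on snd C" and fin: "finite (moduli C)"
    and cover: "\<exists>(r, n)\<in>C. [y = r] (mod int n)"
    using C unfolding distinct_covering_system_def covering_system_def moduli_def by simp_all
  from cover obtain r n where rn: "(r, n) \<in> C" "[y = r] (mod int n)" by auto
  have "(\<rho> n, n) \<in> C" unfolding \<rho>_def by (rule someI) (fact rn)
  hence "\<rho> n = r" using inj_onD[OF inj, of "(\<rho> n, n)" "(r, n)"] rn(1) by simp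
  moreover have n: "n \<in> moduli C" using rn(1) unfolding moduli_def by force
  hence "n dvd L" using assms(3) unfolding lcm_moduli_def by (meson dvd_Lcm dvd_trans)
  moreover have "4 \<le> n"
    using Min_le[OF fin n] assms(2) unfolding least_modulus_def by simp
  ultimately show "\<exists>n. n dvd L \<and> 4 \<le> n \<and> [y = \<rho> n] (mod int n)" using rn(2) by blast
qed

section \<open>Two explicit covering systems\<close>

text \<open>Moduli are integers here so that the test runs on binary numerals.\<close>

definition covers :: "(int \<times> int) list \<Rightarrow> int \<Rightarrow> bool" where
  "covers xs y = list_ex (\<lambda>(r, n). (y - r) mod n = 0) xs"

lemma distinct_covering_system_of_list:
  assumes C: "C = (\<lambda>(r, n). (r, nat n)) ` set xs"
    and L: "L > 0" "list_all (covers xs) [0..L - 1]"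
    and dvd: "list_all (\<lambda>(r, n). n > 1 \<and> L mod n = 0) xs" and "distinct (map snd xs)"
  shows "distinct_covering_system C" "moduli C = set (map (nat \<circ> snd) xs)"
proof -
  show mod: "moduli C = set (map (nat \<circ> snd) xs)"
    unfolding moduli_def C by force
  have gt: "n > 1" "n dvd L" if "(r, n) \<in> set xs" for r n
    using dvd that by (auto simp: list_all_iff)
  have "\<exists>(r, n)\<in>C. [x = r] (mod int n)" for x
  proof -
    have "x mod L \<in> set [0..L - 1]" using L(1) by simp
    hence "covers xs (x mod L)" using L(2) by (metis list_all_iff)
    then obtain r n where rn: "(r, n) \<in> set xs" "(x mod L - r) mod n = 0"
      by (auto simp: covers_def list_ex_iff)
    hence "[x mod L = r] (mod n)" by (simp add: cong_iff_dvd_diff mod_eq_0_iff_dvd)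
    moreover have "[x mod L = x] (mod n)"
      by (rule cong_dvd_modulus[of _ _ L]) (use gt[OF rn(1)] in auto)
    ultimately have "[x = r] (mod int (nat n))"
      using gt[OF rn(1)] by (metis cong_sym cong_trans int_nat_eq less_trans zero_less_one not_less order.asym)
    thus ?thesis using rn(1) unfolding C by force
  qed
  moreover have "inj_on snd C"
  proof -
    have "inj_on snd (set xs)" using assms(5) by (simp add: distinct_map)
    thus ?thesis unfolding C inj_on_def using gt
      by fastforce
  qed
  ultimately show "distinct_covering_system C"
    unfolding distinct_covering_system_def covering_system_def mod
    using gt by (force simp: C)
qed

text \<open>The residues in both systems were found by a randomised local search.\<close>

lemma cover_360:
  "\<exists>C. distinct_covering_system C \<and> least_modulus C = 4 \<and> lcm_moduli C = 360"
proof -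
  let ?xs = "[(1,4),(0,5),(2,6),(3,8),(6,9),(6,10),(11,12),(7,15),(12,18),(4,20),(7,24),(28,30),
    (3,36),(6,40),(27,45),(34,60),(63,72),(18,90),(72,120),(54,180),(38,360)] :: (int \<times> int) list"
  define C where "C = (\<lambda>(r, n). (r, nat n)) ` set ?xs"
  have check: "list_all (covers ?xs) [0..360 - 1]" by code_simp
  have C: "distinct_covering_system C" "moduli C = set (map (nat \<circ> snd) ?xs)"
    by (rule distinct_covering_system_of_list[OF C_def _ check]; simp)+
  have "least_modulus C = 4" "lcm_moduli C = 360"
    unfolding least_modulus_def lcm_moduli_def C(2) by (simp_all add: gcd_lcm_numeral)
  with C(1) show ?thesis by blast
qed

lemma cover_480:
  "\<exists>C. distinct_covering_system C \<and> least_modulus C = 4 \<and> lcm_moduli C = 480 \<and> 240 \<notin> moduli C"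
proof -
  let ?xs = "[(0,4),(4,5),(3,6),(6,8),(3,10),(1,12),(2,15),(10,16),(11,20),(19,24),(5,30),(18,32),
    (7,40),(34,48),(41,60),(66,80),(66,96),(55,120),(130,160),(98,480)] :: (int \<times> int) list"
  define C where "C = (\<lambda>(r, n). (r, nat n)) ` set ?xs"
  have check: "list_all (covers ?xs) [0..480 - 1]" by code_simp
  have C: "distinct_covering_system C" "moduli C = set (map (nat \<circ> snd) ?xs)"
    by (rule distinct_covering_system_of_list[OF C_def _ check]; simp)+
  have "least_modulus C = 4" "lcm_moduli C = 480" "240 \<notin> moduli C"
    unfolding least_modulus_def lcm_moduli_def C(2) by (simp_all add: gcd_lcm_numeral)
  with C(1) show ?thesis by blast
qed

section \<open>The classification for least modulus 4\<close>

theorem theorem1p6: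
  "(\<forall>(C :: congruence set) (a :: nat) (b :: nat) (c :: nat).
      distinct_covering_system C \<and> least_modulus C = 4 \<and>
      lcm_moduli C = 2 ^ a * 3 ^ b * 5 ^ c \<and>
      a > 0 \<and> b > 0 \<and> c > 0 \<and> a \<ge> b \<and> b \<ge> c \<longrightarrow>
        a \<ge> 3 \<and> (a = 3 \<longrightarrow> b \<ge> 2) \<and> (b = 1 \<longrightarrow> a \<ge> 5)) \<and>
   (\<exists>C. distinct_covering_system C \<and> least_modulus C = 4 \<and>
        lcm_moduli C = 2 ^ 3 * 3 ^ 2 * 5 ^ 1) \<and>
   (\<exists>C. distinct_covering_system C \<and> least_modulus C = 4 \<and>
        lcm_moduli C = 2 ^ 5 * 3 ^ 1 * 5 ^ 1 \<and> 240 \<notin> moduli C)"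
proof (intro conjI)
  show "\<exists>C. distinct_covering_system C \<and> least_modulus C = 4 \<and>
        lcm_moduli C = 2 ^ 3 * 3 ^ 2 * 5 ^ 1"
    using cover_360 by simp
  show "\<exists>C. distinct_covering_system C \<and> least_modulus C = 4 \<and>
        lcm_moduli C = 2 ^ 5 * 3 ^ 1 * 5 ^ 1 \<and> 240 \<notin> moduli C"
    using cover_480 by simp
  show "\<forall>(C :: congruence set) (a :: nat) (b :: nat) (c :: nat).
      distinct_covering_system C \<and> least_modulus C = 4 \<and>
      lcm_moduli C = 2 ^ a * 3 ^ b * 5 ^ c \<and>
      a > 0 \<and> b > 0 \<and> c > 0 \<and> a \<ge> b \<and> b \<ge> c \<longrightarrow>
        a \<ge> 3 \<and> (a = 3 \<longrightarrow> b \<ge> 2) \<and> (b = 1 \<longrightarrow> a \<ge> 5)"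
  proof (intro allI impI)
    fix C :: "congruence set" and a b c :: nat
    assume *: "distinct_covering_system C \<and> least_modulus C = 4 \<and>
      lcm_moduli C = 2 ^ a * 3 ^ b * 5 ^ c \<and>
      a > 0 \<and> b > 0 \<and> c > 0 \<and> a \<ge> b \<and> b \<ge> c"
    have dvd: "lcm_moduli C dvd 2 ^ i * 3 ^ j * 5 ^ k" if "a \<le> i" "b \<le> j" "c \<le> k" for i j k
      using * that by (simp add: mult_dvd_mono le_imp_power_dvd)
    have "\<not> lcm_moduli C dvd 900"
      using covering_moduli[of C 900] no_cover_900 * by blast
    hence "\<not> (a \<le> 2)" using dvd[of 2 2 2] * by auto
    moreover have "\<not> lcm_moduli C dvd 240"
      using covering_moduli[of C 240] no_cover_240 * by blast
    hence "\<not> (a \<le> 4 \<and> b = 1)" using dvd[of 4 1 1] * by auto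
    ultimately show "a \<ge> 3 \<and> (a = 3 \<longrightarrow> b \<ge> 2) \<and> (b = 1 \<longrightarrow> a \<ge> 5)" using * by auto
  qed
qed

end
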